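(* Let $A, B, C, D, E, F, X, Y$ be $n \times n$ complex matrices with $$A X^2 + B Y^2 + CXY + DX + EY + F = 0 .$$ Suppose that $X$ and $Y$ have common right eigenvectors corresponding to all their eigenvalues (not necessarily the same eigenvalues for $X$ and $Y$). Then all the eigenvalues of $X$ and $Y$ are zeros of the bivariate determinantal polynomial $$\det\left(\alpha^2 A + \mu^2 B + \alpha\mu\, C + \alpha D + \mu E + F\right),$$ in the sense that for every eigenvalue $\alpha$ of $X$ and every corresponding eigenvalue $\mu$ of $Y$ one has $\det\left(\alpha^2 A + \mu^2 B + \alpha\mu\, C + \alpha D + \mu E + F\right) = 0$.
   Context: An eigenvalue $\alpha$ of $X$ and an eigenvalue $\mu$ of $Y$ are called corresponding if there is a nonzero column vector $v$ (a common right eigenvector) with $Xv = \alpha v$ and $Yv = \mu v$. "$X$ and $Y$ have common right eigenvectors corresponding to all their eigenvalues" means that every eigenvalue of $X$ has a corresponding eigenvalue of $Y$, and every eigenvalue of $Y$ has a corresponding eigenvalue of $X$. *)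

theory Defs
  imports Complex_Main "Jordan_Normal_Form.Char_Poly"
begin

definition corresponding_eigenvalues :: "complex mat \<Rightarrow> complex mat \<Rightarrow> complex \<Rightarrow> complex \<Rightarrow> bool" where
  "corresponding_eigenvalues X Y \<alpha> \<mu> \<longleftrightarrow>
     eigenvalue X \<alpha> \<and> eigenvalue Y \<mu> \<and> (\<exists>v. eigenvector X v \<alpha> \<and> eigenvector Y v \<mu>)"

definition common_right_eigenvectors :: "complex mat \<Rightarrow> complex mat \<Rightarrow> bool" where
  "common_right_eigenvectors X Y \<longleftrightarrow>
     (\<forall>\<alpha>. eigenvalue X \<alpha> \<longrightarrow> (\<exists>\<mu>. eigenvalue Y \<mu> \<and> corresponding_eigenvalues X Y \<alpha> \<mu>)) \<and>
     (\<forall>\<mu>. eigenvalue Y \<mu> \<longrightarrow> (\<exists>\<alpha>. eigenvalue X \<alpha> \<and> corresponding_eigenvalues X Y \<alpha> \<mu>))"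

definition bivariate_det ::
  "complex mat \<Rightarrow> complex mat \<Rightarrow> complex mat \<Rightarrow> complex mat \<Rightarrow> complex mat \<Rightarrow> complex mat
   \<Rightarrow> complex \<Rightarrow> complex \<Rightarrow> complex" where
  "bivariate_det A B C D E F \<alpha> \<mu> =
     det (\<alpha>^2 \<cdot>\<^sub>m A + \<mu>^2 \<cdot>\<^sub>m B + (\<alpha> * \<mu>) \<cdot>\<^sub>m C + \<alpha> \<cdot>\<^sub>m D + \<mu> \<cdot>\<^sub>m E + F)"

end

theory Submission
  imports Defs
begin

text \<open>
  Let \<open>v\<close> be a common eigenvector with \<open>X v = \<alpha> v\<close> and \<open>Y v = \<mu> v\<close>.  In each monomial of the
  matrix equation the unknowns stand to the right of the coefficient, so that on \<open>v\<close> they act as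
  the scalars \<open>\<alpha>\<close> and \<open>\<mu>\<close>, and these commute with the coefficient.  Hence the left-hand
  side of the equation and the matrix whose determinant is taken agree on \<open>v\<close>.  As the former is the
  zero matrix, the nonzero vector \<open>v\<close> lies in the kernel of the latter, whose determinant
  therefore vanishes.
\<close>

lemma mult_mat_vec_smult_mat:
  fixes A :: "'a :: comm_ring_1 mat"
  assumes "A \<in> carrier_mat n m" "v \<in> carrier_vec m"
  shows "(k \<cdot>\<^sub>m A) *\<^sub>v v = k \<cdot>\<^sub>v (A *\<^sub>v v)"
  using assms by (intro eq_vecI) auto

text \<open>
  One monomial of the equation: on an eigenvector, the factor \<open>M\<close> may be traded for its eigenvalue
  because it is applied first and scalars pass through \<open>A\<close>.
\<close>

lemma mult_mat_mult_eigen_vec: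
  fixes A M :: "'a :: comm_ring_1 mat"
  assumes "A \<in> carrier_mat n n" "M \<in> carrier_mat n n" "v \<in> carrier_vec n"
    and "M *\<^sub>v v = k \<cdot>\<^sub>v v"
  shows "(A * M) *\<^sub>v v = (k \<cdot>\<^sub>m A) *\<^sub>v v"
proof -
  have "(A * M) *\<^sub>v v = A *\<^sub>v (k \<cdot>\<^sub>v v)"
    using assms by (simp add: assoc_mult_mat_vec[of A n n M n])
  also have "\<dots> = (k \<cdot>\<^sub>m A) *\<^sub>v v"
    using assms by (intro eq_vecI) auto
  finally show ?thesis .
qed

lemma mult_mat_vec_add6:
  fixes P Q R S T U :: "'a :: comm_ring_1 mat"
  assumes "P \<in> carrier_mat n n" "Q \<in> carrier_mat n n" "R \<in> carrier_mat n n"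
    "S \<in> carrier_mat n n" "T \<in> carrier_mat n n" "U \<in> carrier_mat n n" "v \<in> carrier_vec n"
  shows "(P + Q + R + S + T + U) *\<^sub>v v =
    P *\<^sub>v v + Q *\<^sub>v v + R *\<^sub>v v + S *\<^sub>v v + T *\<^sub>v v + U *\<^sub>v v"
  using assms by (intro eq_vecI) (auto simp: add_scalar_prod_distrib[of _ n])

theorem lemma3:
  fixes n :: nat and A B C D E F X Y :: "complex mat"
  assumes "A \<in> carrier_mat n n" and "B \<in> carrier_mat n n" and "C \<in> carrier_mat n n"
    and "D \<in> carrier_mat n n" and "E \<in> carrier_mat n n" and "F \<in> carrier_mat n n"
    and "X \<in> carrier_mat n n" and "Y \<in> carrier_mat n n"
    and "A * (X ^\<^sub>m 2) + B * (Y ^\<^sub>m 2) + C * X * Y + D * X + E * Y + F = 0\<^sub>m n n"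
    and "common_right_eigenvectors X Y"
  shows "\<forall>\<alpha> \<mu>. eigenvalue X \<alpha> \<and> eigenvalue Y \<mu> \<and> corresponding_eigenvalues X Y \<alpha> \<mu>
           \<longrightarrow> bivariate_det A B C D E F \<alpha> \<mu> = 0"
proof (intro allI impI)
  fix \<alpha> \<mu>
  note [simp] = assms(1-8)
  assume "eigenvalue X \<alpha> \<and> eigenvalue Y \<mu> \<and> corresponding_eigenvalues X Y \<alpha> \<mu>"
  then obtain v where eX: "eigenvector X v \<alpha>" and eY: "eigenvector Y v \<mu>"
    unfolding corresponding_eigenvalues_def by blast
  have v[simp]: "v \<in> carrier_vec n" and v0: "v \<noteq> 0\<^sub>v n"
    and Xv: "X *\<^sub>v v = \<alpha> \<cdot>\<^sub>v v" and Yv: "Y *\<^sub>v v = \<mu> \<cdot>\<^sub>v v"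
    using eX eY assms(7,8) unfolding eigenvector_def by auto
  have XYv: "(X * Y) *\<^sub>v v = (\<alpha> * \<mu>) \<cdot>\<^sub>v v"
    using mult_mat_mult_eigen_vec[OF assms(7,8) v Yv]
    by (simp add: mult_mat_vec_smult_mat[OF assms(7) v] Xv smult_smult_assoc mult.commute)
  let ?M = "\<alpha>^2 \<cdot>\<^sub>m A + \<mu>^2 \<cdot>\<^sub>m B + (\<alpha> * \<mu>) \<cdot>\<^sub>m C + \<alpha> \<cdot>\<^sub>m D + \<mu> \<cdot>\<^sub>m E + F"
  \<comment> \<open>The mixed term is regrouped as \<open>C * (X * Y)\<close> so that the product of the unknowns, which has
    \<open>v\<close> as an eigenvector, is a single factor.\<close>
  have "?M *\<^sub>v v
      = (A * (X ^\<^sub>m 2) + B * (Y ^\<^sub>m 2) + C * (X * Y) + D * X + E * Y + F) *\<^sub>v v"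
    using mult_mat_mult_eigen_vec[OF assms(1) _ v eigenvector_pow[OF assms(7) eX, of 2]]
      mult_mat_mult_eigen_vec[OF assms(2) _ v eigenvector_pow[OF assms(8) eY, of 2]]
      mult_mat_mult_eigen_vec[OF assms(3) _ v XYv]
      mult_mat_mult_eigen_vec[OF assms(4) _ v Xv]
      mult_mat_mult_eigen_vec[OF assms(5) _ v Yv]
    by (simp add: mult_mat_vec_add6[of _ n] mult_carrier_mat[of _ n n])
  also have "\<dots> = 0\<^sub>v n"
    using assms(9) by (intro eq_vecI) (simp_all add: assoc_mult_mat[of C n n X n Y n, symmetric])
  finally have "?M *\<^sub>v v = 0\<^sub>v n" .
  moreover have "?M \<in> carrier_mat n n"
    by simp
  ultimately have "det ?M = 0"
    using det_0_iff_vec_prod_zero[of ?M n] v v0 by blast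
  then show "bivariate_det A B C D E F \<alpha> \<mu> = 0"
    unfolding bivariate_det_def .
qed

end
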